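(* The function $c\mapsto PPTP(N,c)$, $c\in[0,\infty)$, has at most $n$ corner points, where $n=|N|$.
   Context: Setting (PPTP on a line). The depot is at the origin of the half-line $[0,\infty)$. $N=\{v_1,\dots,v_n\}$ ($n\ge 1$) is the set of potential customers; customer $v_i$ has position $x_i>0$, prize $p_i>0$ and probability $\pi_i\in(0,1]$. Customers are indexed so that $x_i\le x_{i+1}$, and $x_i=x_{i+1}$ implies $\pi_i\le\pi_{i+1}$. Put $l_i=2x_i$. For $S\subseteq N$ define the expected revenue $R(S)=\sum_{v_i\in S}\pi_ip_i$, the expected distance $L(S)=\sum_{v_i\in S} l_i\pi_i\prod_{v_j\in S,\,j>i}(1-\pi_j)$ and, for a unit cost $c\ge 0$, the expected profit $G(S,c)=R(S)-cL(S)$. Empty sums are $0$, empty products are $1$. $PPTP(N,c)=\max_{S\subseteq N}G(S,c)$ for $c\ge0$. The function $c\mapsto PPTP(N,c)$ on $[0,\infty)$ is piecewise linear, and a corner point is a point $c>0$ at which its slope changes (the left and right slopes differ). *)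

theory Defs
  imports "HOL-Analysis.Analysis"
begin

text \<open>
  Customer \<open>v\<^sub>i\<close> is identified with its index \<open>i\<close>, so the customer set is \<open>{1..n}\<close>; position, prize
  and probability are functions of the index, only their values on \<open>{1..n}\<close> matter.
\<close>

definition revenue :: "(nat \<Rightarrow> real) \<Rightarrow> (nat \<Rightarrow> real) \<Rightarrow> nat set \<Rightarrow> real" where
  "revenue p \<pi> S = (\<Sum>i\<in>S. \<pi> i * p i)"

text \<open>
  The tour realised from \<open>S\<close> has length \<open>2 * x i\<close> when \<open>i\<close> is the present customer of largest index.
\<close>

definition distance :: "(nat \<Rightarrow> real) \<Rightarrow> (nat \<Rightarrow> real) \<Rightarrow> nat set \<Rightarrow> real" where
  "distance x \<pi> S = (\<Sum>i\<in>S. (2 * x i) * \<pi> i * (\<Prod>j\<in>{j \<in> S. j > i}. 1 - \<pi> j))"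

definition profit ::
  "(nat \<Rightarrow> real) \<Rightarrow> (nat \<Rightarrow> real) \<Rightarrow> (nat \<Rightarrow> real) \<Rightarrow> nat set \<Rightarrow> real \<Rightarrow> real" where
  "profit x p \<pi> S c = revenue p \<pi> S - c * distance x \<pi> S"

definition PPTP ::
  "(nat \<Rightarrow> real) \<Rightarrow> (nat \<Rightarrow> real) \<Rightarrow> (nat \<Rightarrow> real) \<Rightarrow> nat \<Rightarrow> real \<Rightarrow> real" where
  "PPTP x p \<pi> n c = Max ((\<lambda>S. profit x p \<pi> S c) ` Pow {1..n})"

text \<open>
  The left and right slopes are the one-sided derivatives. Since \<open>c > 0\<close>, they depend only on the
  values of \<open>f\<close> on the nonnegative reals.
\<close>

definition corner_point :: "(real \<Rightarrow> real) \<Rightarrow> real \<Rightarrow> bool" where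
  "corner_point f c \<longleftrightarrow> c > 0 \<and>
     (\<exists>a b. (f has_real_derivative a) (at_left c) \<and>
            (f has_real_derivative b) (at_right c) \<and> a \<noteq> b)"

end

theory Submission
  imports Defs
begin

text \<open>
  The expected distance is the expectation of the largest value \<open>2 * x i\<close> over the present customers
  of \<open>S\<close>. A maximum over a set is monotone and submodular in the set, and so is its expectation. The
  profit \<open>R - c L\<close> therefore rewards larger sets less and less as \<open>c\<close> grows, and the usual comparison
  of \<open>S \<union> T\<close> and \<open>S \<inter> T\<close> with \<open>S\<close> and \<open>T\<close> shows that the optimal sets shrink: every set optimal at
  \<open>c'\<close> is contained in every set optimal at a smaller \<open>c \<ge> 0\<close>
  (\<open>optimal_sets_antimono\<close>). Positive expected prizes rule out ties there.

  If only one set is optimal at \<open>c\<close>, it stays optimal near \<open>c\<close>, and the profit function is linear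
  there. So at a corner point two different sets \<open>A\<close> and \<open>B\<close> are optimal, and all sets that are optimal
  later lie in \<open>A \<inter> B\<close>, which is smaller than \<open>A\<close> or than \<open>B\<close>. Hence the largest cardinality of an
  optimal set drops strictly from each corner point to the next. At corner points it is also positive,
  so it takes at most \<open>n\<close> values.
\<close>

section \<open>The expected distance is monotone and submodular\<close>

lemma distance_insert_last:
  assumes "S \<subseteq> {1..m}"
  shows "distance x \<pi> (insert (Suc m) S)
       = 2 * x (Suc m) * \<pi> (Suc m) + (1 - \<pi> (Suc m)) * distance x \<pi> S"
proof -
  have fin: "finite S" and last: "Suc m \<notin> S"
    using assms finite_subset by auto
  have none: "{j \<in> insert (Suc m) S. j > Suc m} = {}"
    using assms by auto
  have step: "(\<Prod>j\<in>{j \<in> insert (Suc m) S. j > i}. 1 - \<pi> j)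
      = (1 - \<pi> (Suc m)) * (\<Prod>j\<in>{j \<in> S. j > i}. 1 - \<pi> j)" if "i \<in> S" for i
  proof -
    have "{j \<in> insert (Suc m) S. j > i} = insert (Suc m) {j \<in> S. j > i}"
      using assms that by auto
    then show ?thesis
      using fin last by simp
  qed
  have "distance x \<pi> (insert (Suc m) S)
      = 2 * x (Suc m) * \<pi> (Suc m)
        + (\<Sum>i\<in>S. 2 * x i * \<pi> i * (\<Prod>j\<in>{j \<in> insert (Suc m) S. j > i}. 1 - \<pi> j))"
    unfolding distance_def sum.insert[OF fin last] none by simp
  also have "(\<Sum>i\<in>S. 2 * x i * \<pi> i * (\<Prod>j\<in>{j \<in> insert (Suc m) S. j > i}. 1 - \<pi> j))
      = (1 - \<pi> (Suc m)) * distance x \<pi> S"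
    unfolding distance_def sum_distrib_left by (rule sum.cong[OF refl], subst step) simp_all
  finally show ?thesis .
qed

lemma subset_atLeastAtMost_Suc_cases:
  assumes "S \<subseteq> {1..Suc m}"
  obtains "S \<subseteq> {1..m}"
    | S' where "S' \<subseteq> {1..m}" "S = insert (Suc m) S'"
proof (cases "Suc m \<in> S")
  case True
  have "S - {Suc m} \<subseteq> {1..m}"
    using assms by (auto simp: le_Suc_eq)
  moreover have "S = insert (Suc m) (S - {Suc m})"
    using True by blast
  ultimately show ?thesis
    using that(2) by blast
next
  case False
  then have "S \<subseteq> {1..m}"
    using assms by (auto simp: subset_iff le_Suc_eq)
  then show ?thesis
    using that(1) by blast
qed

lemma distance_le_last:
  assumes "S \<subseteq> {1..m}" "m \<in> {1..n}"
    and x: "\<And>i. i \<in> {1..n} \<Longrightarrow> 0 \<le> x i"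
    and \<pi>: "\<And>i. i \<in> {1..n} \<Longrightarrow> 0 \<le> \<pi> i \<and> \<pi> i \<le> 1"
    and mono: "\<And>i. i \<in> {1..<n} \<Longrightarrow> x i \<le> x (Suc i)"
  shows "distance x \<pi> S \<le> 2 * x m"
  using assms(1,2)
proof (induction m arbitrary: S)
  case 0
  then show ?case by simp
next
  case (Suc m)
  have inner: "distance x \<pi> A \<le> 2 * x (Suc m)" if "A \<subseteq> {1..m}" for A
  proof (cases "m = 0")
    case True
    then show ?thesis
      using that x[of "Suc m"] Suc.prems by (simp add: distance_def)
  next
    case False
    then have "distance x \<pi> A \<le> 2 * x m"
      using that Suc by simp
    also have "\<dots> \<le> 2 * x (Suc m)"
      using mono[of m] False Suc.prems by simp
    finally show ?thesis .
  qed
  from Suc.prems(1) show ?case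
  proof (cases rule: subset_atLeastAtMost_Suc_cases)
    case 1
    then show ?thesis
      by (rule inner)
  next
    case (2 S')
    have "(1 - \<pi> (Suc m)) * distance x \<pi> S' \<le> (1 - \<pi> (Suc m)) * (2 * x (Suc m))"
      using \<pi>[of "Suc m"] Suc.prems inner[OF 2(1)] by (intro mult_left_mono) auto
    then show ?thesis
      unfolding 2(2) distance_insert_last[OF 2(1)] by (simp add: algebra_simps)
  qed
qed

text \<open>
  The induction adds the outermost customer. If this customer joins only the larger set, then a
  distance of at most \<open>2 * x (Suc m)\<close> is replaced by an average of that distance and
  \<open>2 * x (Suc m)\<close>; this is where the order of the positions enters.
\<close>

lemma distance_mono:
  assumes "S \<subseteq> T" "T \<subseteq> {1..m}" "m \<le> n"
    and x: "\<And>i. i \<in> {1..n} \<Longrightarrow> 0 \<le> x i"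
    and \<pi>: "\<And>i. i \<in> {1..n} \<Longrightarrow> 0 \<le> \<pi> i \<and> \<pi> i \<le> 1"
    and mono: "\<And>i. i \<in> {1..<n} \<Longrightarrow> x i \<le> x (Suc i)"
  shows "distance x \<pi> S \<le> distance x \<pi> T"
  using assms(1-3)
proof (induction m arbitrary: S T)
  case 0
  then show ?case by simp
next
  case (Suc m)
  let ?q = "\<pi> (Suc m)"
  have q: "0 \<le> ?q" "?q \<le> 1"
    using \<pi>[of "Suc m"] Suc.prems by auto
  have IH: "distance x \<pi> A \<le> distance x \<pi> B" if "A \<subseteq> B" "B \<subseteq> {1..m}" for A B
    using Suc.IH that Suc.prems by simp
  from Suc.prems(2) show ?case
  proof (cases rule: subset_atLeastAtMost_Suc_cases)
    case 1
    then show ?thesis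
      using IH Suc.prems by blast
  next
    case T: (2 T')
    have "S \<subseteq> {1..Suc m}"
      using Suc.prems by blast
    then show ?thesis
    proof (cases rule: subset_atLeastAtMost_Suc_cases)
      case 1
      then have "S \<subseteq> T'"
        using Suc.prems T by auto
      then have "(1 - ?q) * distance x \<pi> S \<le> (1 - ?q) * distance x \<pi> T'"
        using IH T q by (intro mult_left_mono) auto
      moreover have "distance x \<pi> S \<le> 2 * x (Suc m)"
        using Suc.prems by (intro distance_le_last[where x = x and \<pi> = \<pi> and n = n, OF _ _ x \<pi> mono])
            (use 1 in auto)
      then have "?q * distance x \<pi> S \<le> ?q * (2 * x (Suc m))"
        using q by (intro mult_left_mono) auto
      ultimately show ?thesis
        unfolding T(2) distance_insert_last[OF T(1)] by (simp add: algebra_simps)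
    next
      case (2 S')
      then have "S' \<subseteq> T'"
        using Suc.prems T by auto
      then have "(1 - ?q) * distance x \<pi> S' \<le> (1 - ?q) * distance x \<pi> T'"
        using IH T q by (intro mult_left_mono) auto
      then show ?thesis
        unfolding T(2) 2(2) distance_insert_last[OF T(1)] distance_insert_last[OF 2(1)] by simp
    qed
  qed
qed

text \<open>
  Condition on the outermost customer \<open>Suc m\<close>, present with probability \<open>q\<close>. If it belongs to
  both sets, the inequality for \<open>m\<close> is multiplied by \<open>1 - q\<close>. If it belongs to one set only, say \<open>S\<close>,
  its contributions to \<open>S\<close> and \<open>S \<union> T\<close> cancel, and what remains is that inequality with weight \<open>1 - q\<close>
  plus \<open>L(S \<inter> T) \<le> L(T)\<close> with weight \<open>q\<close>.
\<close>

lemma distance_submodular: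
  assumes "S \<subseteq> {1..m}" "T \<subseteq> {1..m}" "m \<le> n"
    and x: "\<And>i. i \<in> {1..n} \<Longrightarrow> 0 \<le> x i"
    and \<pi>: "\<And>i. i \<in> {1..n} \<Longrightarrow> 0 \<le> \<pi> i \<and> \<pi> i \<le> 1"
    and mono: "\<And>i. i \<in> {1..<n} \<Longrightarrow> x i \<le> x (Suc i)"
  shows "distance x \<pi> (S \<union> T) + distance x \<pi> (S \<inter> T) \<le> distance x \<pi> S + distance x \<pi> T"
  using assms(1-3)
proof (induction m arbitrary: S T)
  case 0
  then show ?case by simp
next
  case (Suc m)
  let ?L = "distance x \<pi>" and ?q = "\<pi> (Suc m)"
  have q: "0 \<le> ?q" "?q \<le> 1"
    using \<pi>[of "Suc m"] Suc.prems by auto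
  have IH: "?L (A \<union> B) + ?L (A \<inter> B) \<le> ?L A + ?L B" if "A \<subseteq> {1..m}" "B \<subseteq> {1..m}" for A B
    using Suc.IH that Suc.prems by simp
  have scaled_IH: "(1 - ?q) * (?L (A \<union> B) + ?L (A \<inter> B)) \<le> (1 - ?q) * (?L A + ?L B)"
    if "A \<subseteq> {1..m}" "B \<subseteq> {1..m}" for A B
    using IH[OF that] q by (intro mult_left_mono) auto
  have one: "?L (insert (Suc m) A \<union> B) + ?L (insert (Suc m) A \<inter> B)
      \<le> ?L (insert (Suc m) A) + ?L B" if AB: "A \<subseteq> {1..m}" "B \<subseteq> {1..m}" for A B
  proof -
    have sets: "insert (Suc m) A \<union> B = insert (Suc m) (A \<union> B)"
      "insert (Suc m) A \<inter> B = A \<inter> B"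
      using AB by auto
    have union: "A \<union> B \<subseteq> {1..m}"
      using AB by blast
    have "?L (A \<inter> B) \<le> ?L B"
      using Suc.prems by (intro distance_mono[where x = x and \<pi> = \<pi> and n = n,
            OF _ AB(2) _ x \<pi> mono]) auto
    then have "?q * ?L (A \<inter> B) \<le> ?q * ?L B"
      using q by (intro mult_left_mono) auto
    then show ?thesis
      unfolding sets distance_insert_last[OF union] distance_insert_last[OF AB(1)]
      using scaled_IH[OF AB] by (simp add: algebra_simps)
  qed
  from Suc.prems(1) show ?case
  proof (cases rule: subset_atLeastAtMost_Suc_cases)
    case S: 1
    from Suc.prems(2) show ?thesis
    proof (cases rule: subset_atLeastAtMost_Suc_cases)
      case 1
      then show ?thesis
        using IH S by blast
    next
      case (2 T')
      then show ?thesis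
        using one[of T' S] S by (simp add: Un_commute Int_commute add.commute)
    qed
  next
    case S: (2 S')
    from Suc.prems(2) show ?thesis
    proof (cases rule: subset_atLeastAtMost_Suc_cases)
      case 1
      then show ?thesis
        using one[of S' T] S by simp
    next
      case (2 T')
      have sets: "S \<union> T = insert (Suc m) (S' \<union> T')" "S \<inter> T = insert (Suc m) (S' \<inter> T')"
        using S 2 by auto
      have sub: "S' \<union> T' \<subseteq> {1..m}" "S' \<inter> T' \<subseteq> {1..m}"
        using S 2 by auto
      show ?thesis
        unfolding sets distance_insert_last[OF sub(1)] distance_insert_last[OF sub(2)]
        unfolding S(2) 2(2) distance_insert_last[OF S(1)] distance_insert_last[OF 2(1)]
        using scaled_IH[OF S(1) 2(1)] by (simp add: algebra_simps)
    qed
  qed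
qed

section \<open>Optimal sets shrink as the unit cost grows\<close>

definition optimal_sets ::
  "(nat \<Rightarrow> real) \<Rightarrow> (nat \<Rightarrow> real) \<Rightarrow> (nat \<Rightarrow> real) \<Rightarrow> nat \<Rightarrow> real \<Rightarrow> nat set set" where
  "optimal_sets x p \<pi> n c = {S. S \<subseteq> {1..n} \<and> profit x p \<pi> S c = PPTP x p \<pi> n c}"

lemma finite_optimal_sets: "finite (optimal_sets x p \<pi> n c)"
  by (rule finite_subset[of _ "Pow {1..n}"]) (auto simp: optimal_sets_def)

lemma profit_le_PPTP: "S \<subseteq> {1..n} \<Longrightarrow> profit x p \<pi> S c \<le> PPTP x p \<pi> n c"
  unfolding PPTP_def by (intro Max_ge) auto

lemma optimal_sets_nonempty: "optimal_sets x p \<pi> n c \<noteq> {}"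
proof -
  have "PPTP x p \<pi> n c \<in> (\<lambda>S. profit x p \<pi> S c) ` Pow {1..n}"
    unfolding PPTP_def by (intro Max_in) auto
  then show ?thesis
    unfolding optimal_sets_def by auto
qed

text \<open>
  Enlarging \<open>S\<close> to \<open>S \<union> T\<close> does not pay at \<open>c\<close>, and shrinking \<open>T\<close> to \<open>S \<inter> T\<close> does not pay at \<open>c'\<close>.
  Both moves change the revenue by that of \<open>T - S\<close>, and by submodularity the first costs no more
  distance than the second saves. As \<open>c < c'\<close>, this is possible only if \<open>T - S\<close> adds neither
  distance nor revenue to \<open>S \<inter> T\<close>; a set without revenue is empty.
\<close>

lemma optimal_sets_antimono:
  assumes x: "\<And>i. i \<in> {1..n} \<Longrightarrow> 0 \<le> x i"
    and p: "\<And>i. i \<in> {1..n} \<Longrightarrow> 0 < p i"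
    and \<pi>: "\<And>i. i \<in> {1..n} \<Longrightarrow> 0 < \<pi> i \<and> \<pi> i \<le> 1"
    and mono: "\<And>i. i \<in> {1..<n} \<Longrightarrow> x i \<le> x (Suc i)"
    and c: "0 \<le> c" "c < c'"
    and S: "S \<in> optimal_sets x p \<pi> n c" and T: "T \<in> optimal_sets x p \<pi> n c'"
  shows "T \<subseteq> S"
proof -
  let ?L = "distance x \<pi>" and ?R = "revenue p \<pi>"
  have sub: "S \<subseteq> {1..n}" "T \<subseteq> {1..n}"
    using S T by (auto simp: optimal_sets_def)
  then have fin: "finite S" "finite T"
    using finite_subset by auto
  have \<pi>': "0 \<le> \<pi> i \<and> \<pi> i \<le> 1" if "i \<in> {1..n}" for i
    using \<pi>[OF that] by simp
  have R: "?R (S \<union> T) = ?R S + ?R (T - S)" "?R T = ?R (S \<inter> T) + ?R (T - S)"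
  proof -
    have "?R (S \<union> (T - S)) = ?R S + ?R (T - S)"
      unfolding revenue_def using fin by (intro sum.union_disjoint) auto
    then show "?R (S \<union> T) = ?R S + ?R (T - S)"
      by simp
    have "?R ((S \<inter> T) \<union> (T - S)) = ?R (S \<inter> T) + ?R (T - S)"
      unfolding revenue_def using fin by (intro sum.union_disjoint) auto
    moreover have "(S \<inter> T) \<union> (T - S) = T"
      by blast
    ultimately show "?R T = ?R (S \<inter> T) + ?R (T - S)"
      by simp
  qed
  have "profit x p \<pi> (S \<union> T) c \<le> profit x p \<pi> S c"
    using profit_le_PPTP[of "S \<union> T" n x p \<pi> c] S sub by (auto simp: optimal_sets_def)
  then have "?R (T - S) \<le> c * (?L (S \<union> T) - ?L S)"
    unfolding profit_def R(1) by (simp add: algebra_simps)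
  also have "\<dots> \<le> c * (?L T - ?L (S \<inter> T))"
    using distance_submodular[where x = x and \<pi> = \<pi> and n = n, OF sub order_refl x \<pi>' mono] c
    by (intro mult_left_mono) auto
  finally have upper: "?R (T - S) \<le> c * (?L T - ?L (S \<inter> T))" .
  have "profit x p \<pi> (S \<inter> T) c' \<le> profit x p \<pi> T c'"
    using profit_le_PPTP[of "S \<inter> T" n x p \<pi> c'] T sub by (auto simp: optimal_sets_def)
  then have lower: "c' * (?L T - ?L (S \<inter> T)) \<le> ?R (T - S)"
    unfolding profit_def R(2) by (simp add: algebra_simps)
  have "?L (S \<inter> T) \<le> ?L T"
    by (rule distance_mono[where x = x and \<pi> = \<pi> and n = n,
          OF _ sub(2) order_refl x \<pi>' mono]) auto
  moreover have "(c' - c) * (?L T - ?L (S \<inter> T)) \<le> 0"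
    using upper lower by (simp add: algebra_simps)
  then have "?L T - ?L (S \<inter> T) \<le> 0"
    using c by (simp add: mult_le_0_iff)
  ultimately have "?L T - ?L (S \<inter> T) = 0"
    by simp
  then have no_revenue: "?R (T - S) \<le> 0"
    using upper by simp
  have "T - S = {}"
  proof (rule ccontr)
    assume "T - S \<noteq> {}"
    then have "0 < ?R (T - S)"
      unfolding revenue_def using fin sub p \<pi> by (intro sum_pos) auto
    then show False
      using no_revenue by simp
  qed
  then show ?thesis
    by blast
qed

section \<open>Corner points have several optimal sets\<close>

lemma eventually_not_optimal:
  assumes "S \<subseteq> {1..n}" "S \<notin> optimal_sets x p \<pi> n c"
  shows "eventually (\<lambda>d. S \<notin> optimal_sets x p \<pi> n d) (nhds c)"
proof -
  obtain T where T: "T \<subseteq> {1..n}" "profit x p \<pi> T c = PPTP x p \<pi> n c"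
    using optimal_sets_nonempty[of x p \<pi> n c] by (auto simp: optimal_sets_def)
  have "profit x p \<pi> S c < profit x p \<pi> T c"
    using assms profit_le_PPTP[of S n x p \<pi> c] T by (auto simp: optimal_sets_def)
  moreover have "((\<lambda>d. profit x p \<pi> T d - profit x p \<pi> S d) \<longlongrightarrow>
      profit x p \<pi> T c - profit x p \<pi> S c) (nhds c)"
    unfolding profit_def by (intro tendsto_intros filterlim_ident)
  ultimately have "eventually (\<lambda>d. 0 < profit x p \<pi> T d - profit x p \<pi> S d) (nhds c)"
    by (intro order_tendstoD(1)) auto
  then show ?thesis
  proof eventually_elim
    case (elim d)
    then show ?case
      using profit_le_PPTP[OF T(1), of x p \<pi> d] by (auto simp: optimal_sets_def)
  qed
qed

text \<open>
  There are finitely many sets, so near \<open>c\<close> only sets that are optimal at \<open>c\<close> are optimal. A single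
  such set \<open>S\<close> gives a two-sided derivative \<open>- L(S)\<close>.
\<close>

lemma corner_point_two_optimal_sets:
  assumes "corner_point (PPTP x p \<pi> n) c"
  obtains A B where "A \<in> optimal_sets x p \<pi> n c" "B \<in> optimal_sets x p \<pi> n c" "A \<noteq> B"
proof -
  obtain S where S: "S \<in> optimal_sets x p \<pi> n c"
    using optimal_sets_nonempty by blast
  have False if unique: "\<And>T. T \<in> optimal_sets x p \<pi> n c \<Longrightarrow> T = S"
  proof -
    have "eventually (\<lambda>d. \<forall>T\<in>Pow {1..n} - {S}. T \<notin> optimal_sets x p \<pi> n d) (nhds c)"
      using unique by (intro eventually_ball_finite) (auto intro!: eventually_not_optimal)
    then have eq: "eventually (\<lambda>d. PPTP x p \<pi> n d = profit x p \<pi> S d) (nhds c)"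
    proof eventually_elim
      case (elim d)
      obtain T where "T \<in> optimal_sets x p \<pi> n d"
        using optimal_sets_nonempty by blast
      with elim show ?case
        by (auto simp: optimal_sets_def)
    qed
    have "((\<lambda>d. profit x p \<pi> S d) has_real_derivative - distance x \<pi> S) (at c)"
      unfolding profit_def by (auto intro!: derivative_eq_intros)
    then have deriv: "(PPTP x p \<pi> n has_real_derivative - distance x \<pi> S) (at c)"
      using DERIV_cong_ev[OF refl eq refl] by simp
    have left: "a = - distance x \<pi> S"
      if "(PPTP x p \<pi> n has_real_derivative a) (at_left c)" for a
      using that has_field_derivative_at_within[OF deriv]
      by (intro tendsto_unique[of "at_left c"]) (auto simp: has_field_derivative_iff)
    have right: "b = - distance x \<pi> S"
      if "(PPTP x p \<pi> n has_real_derivative b) (at_right c)" for b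
      using that has_field_derivative_at_within[OF deriv]
      by (intro tendsto_unique[of "at_right c"]) (auto simp: has_field_derivative_iff)
    show False
      using assms left right unfolding corner_point_def by blast
  qed
  then show ?thesis
    using S that by metis
qed

section \<open>Counting corner points\<close>

theorem proposition11:
  fixes n :: nat and x p \<pi> :: "nat \<Rightarrow> real"
  assumes "n \<ge> 1"
    and "\<And>i. i \<in> {1..n} \<Longrightarrow> x i > 0"
    and "\<And>i. i \<in> {1..n} \<Longrightarrow> p i > 0"
    and "\<And>i. i \<in> {1..n} \<Longrightarrow> 0 < \<pi> i \<and> \<pi> i \<le> 1"
    and "\<And>i. i \<in> {1..<n} \<Longrightarrow> x i \<le> x (i + 1)"
    and "\<And>i. i \<in> {1..<n} \<Longrightarrow> x i = x (i + 1) \<Longrightarrow> \<pi> i \<le> \<pi> (i + 1)"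
  shows "finite {c. corner_point (PPTP x p \<pi> n) c} \<and>
         card {c. corner_point (PPTP x p \<pi> n) c} \<le> n"
proof -
  let ?C = "{c. corner_point (PPTP x p \<pi> n) c}" and ?O = "optimal_sets x p \<pi> n"
  define M where "M c = Max (card ` ?O c)" for c
  have M_ge: "card S \<le> M c" if "S \<in> ?O c" for S c
    unfolding M_def using that finite_optimal_sets by (intro Max_ge) auto
  have M_attained: "\<exists>S\<in>?O c. M c = card S" for c
  proof -
    have "M c \<in> card ` ?O c"
      unfolding M_def using finite_optimal_sets optimal_sets_nonempty by (intro Max_in) auto
    then show ?thesis
      by blast
  qed
  have small_Int: "card (A \<inter> B) < M c" if "A \<in> ?O c" "B \<in> ?O c" "A \<noteq> B" for A B c
  proof -
    have fin: "finite A" "finite B"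
      using that by (auto simp: optimal_sets_def intro: finite_subset)
    from \<open>A \<noteq> B\<close> have "A \<inter> B \<subset> A \<or> A \<inter> B \<subset> B"
      by blast
    then have "card (A \<inter> B) < card A \<or> card (A \<inter> B) < card B"
      using psubset_card_mono fin by metis
    then show ?thesis
      using M_ge that by (meson order_less_le_trans)
  qed
  have decreasing: "M c' < M c" if "c \<in> ?C" "c < c'" for c c'
  proof -
    from that(1) obtain A B where AB: "A \<in> ?O c" "B \<in> ?O c" "A \<noteq> B"
      using corner_point_two_optimal_sets by blast
    obtain T where T: "T \<in> ?O c'" "M c' = card T"
      using M_attained by blast
    have "0 \<le> c"
      using that by (simp add: corner_point_def)
    then have nested: "T \<subseteq> S" if "S \<in> ?O c" for S
      using optimal_sets_antimono[where x = x and p = p and \<pi> = \<pi> and n = n,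
          OF _ assms(3,4) _ _ \<open>c < c'\<close> that T(1)] assms(2,5)
      by (simp add: less_imp_le)
    have "finite (A \<inter> B)"
      using AB by (auto simp: optimal_sets_def intro: finite_subset)
    then have "card T \<le> card (A \<inter> B)"
      using nested AB by (intro card_mono) auto
    then show ?thesis
      using small_Int[OF AB] T by simp
  qed
  have "inj_on M ?C"
  proof (rule inj_onI)
    fix c c'
    assume "c \<in> ?C" "c' \<in> ?C" "M c = M c'"
    then show "c = c'"
      using decreasing[of c c'] decreasing[of c' c] by (cases c c' rule: linorder_cases) auto
  qed
  moreover have "M ` ?C \<subseteq> {1..n}"
  proof safe
    fix c
    assume "corner_point (PPTP x p \<pi> n) c"
    then obtain A B where "A \<in> ?O c" "B \<in> ?O c" "A \<noteq> B"
      using corner_point_two_optimal_sets by blast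
    then have "0 < M c"
      using small_Int by fastforce
    obtain S where S: "S \<in> ?O c" "M c = card S"
      using M_attained by blast
    then have "card S \<le> card {1..n}"
      by (intro card_mono) (auto simp: optimal_sets_def)
    then show "M c \<in> {1..n}"
      using S \<open>0 < M c\<close> by simp
  qed
  ultimately show ?thesis
    using inj_on_finite[of M ?C "{1..n}"] card_inj_on_le[of M ?C "{1..n}"] by simp
qed

end
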